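(* Let $l,m$ be positive integers, let $\phi:\mathbb{N}\to(0,1)$ be non-increasing, and let $\bm{M}\in\mathbb{R}^{l\times m}$ satisfy $\prod_{u=1}^l\|\bm{j}\cdot\mathrm{row}_u(\bm{M})\|\ge\phi(|\bm{j}|)$ for all $\bm{j}\in\mathbb{Z}^m\setminus\{\bm{0}\}$. Then for every positive integer $J$, $$\sum_{\substack{\bm{j}\in\mathbb{Z}^m\setminus\{\bm{0}\}\\|\bm{j}|\le J}}\prod_{u=1}^l\|\bm{j}\cdot\mathrm{row}_u(\bm{M})\|^{-1}\le\frac{4^l}{\phi(2J)}\binom{l+\lfloor\log_2\frac{1}{\phi(J)}\rfloor}{l}.$$
   Context: $\mathrm{row}_u(\bm{M})$ denotes the $u$-th row of $\bm{M}$, $\|y\|$ is the distance from $y\in\mathbb{R}$ to the nearest integer, and $|\bm{j}|$ is the supremum norm. *)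

theory Defs
  imports "HOL-Analysis.Analysis"
begin

definition dist_nearest_int :: "real \<Rightarrow> real" where
  "dist_nearest_int y = \<bar>y - of_int (round y)\<bar>"

definition int_sup_norm :: "int ^ 'n \<Rightarrow> nat" where
  "int_sup_norm j = Max (range (\<lambda>i. nat \<bar>j $ i\<bar>))"

definition real_vec :: "int ^ 'n \<Rightarrow> real ^ 'n" where
  "real_vec j = (\<chi> i. of_int (j $ i))"

end

theory Submission
  imports Defs
begin

text \<open>
  Reduce the inner products \<open>j \<cdot> row\<^sub>u\<close> modulo 1 to residues in \<open>[-1/2, 1/2]\<close> and sort the points
  \<open>j\<close> by the signs and the dyadic sizes \<open>2\<^bsup>-k\<^sub>u-1\<^esup> < \<bar>s\<^sub>u\<bar> \<le> 2\<^bsup>-k\<^sub>u\<^esup>\<close> of their residues \<open>s\<^sub>u\<close>.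
  The hypothesis at \<open>j\<close> forces \<open>\<Sum> k\<^sub>u \<le> log\<^sub>2 (1/\<phi>(J))\<close>, which leaves at most \<open>2\<^sup>l\<close> times the
  binomial coefficient many cells.  Two points of one cell differ by a nonzero vector of norm at
  most \<open>2J\<close>, so the hypothesis at the difference separates them: slicing the cell, a box of
  volume \<open>V\<close>, along one coordinate shows that it contains at most \<open>\<lceil>V/\<phi>(2J)\<rceil> \<le> 2\<^sup>lV/\<phi>(2J)\<close>
  points.  Every summand being at most \<open>1/V\<close>, the cell contributes at most \<open>2\<^sup>l/\<phi>(2J)\<close>.
\<close>

subsection \<open>Counting functions of bounded sum\<close>

lemma bij_betw_map_PiE:
  assumes "distinct xs"
  shows "bij_betw (\<lambda>f. map f xs) (set xs \<rightarrow>\<^sub>E UNIV) {ys. length ys = length xs}"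
proof (intro bij_betwI')
  show "map f xs = map g xs \<longleftrightarrow> f = g" if "f \<in> set xs \<rightarrow>\<^sub>E UNIV" "g \<in> set xs \<rightarrow>\<^sub>E UNIV" for f g
    using that by (auto intro: PiE_ext)
  show "\<exists>f \<in> set xs \<rightarrow>\<^sub>E UNIV. ys = map f xs" if "ys \<in> {ys. length ys = length xs}" for ys
  proof
    show "ys = map (\<lambda>x\<in>set xs. the (map_of (zip xs ys) x)) xs"
      using assms that by (intro nth_equalityI) (auto simp: map_of_zip_nth)
  qed auto
qed simp

lemma
  assumes "finite A"
  shows finite_PiE_sum_le: "finite {k \<in> A \<rightarrow>\<^sub>E (UNIV :: nat set). sum k A \<le> n}" (is "finite ?K")
    and card_PiE_sum_le:
      "card {k \<in> A \<rightarrow>\<^sub>E (UNIV :: nat set). sum k A \<le> n} = (card A + n) choose card A"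
proof -
  obtain xs where xs: "set xs = A" "distinct xs"
    using finite_distinct_list[OF assms] by blast
  have length_xs: "length xs = card A"
    using xs distinct_card by fastforce
  have sum_list_xs: "sum_list (map k xs) = sum k A" for k :: "'a \<Rightarrow> nat"
    using xs by (simp add: sum_list_distinct_conv_sum_set)
  define lists where "lists = {ys :: nat list. length ys = Suc (card A) \<and> sum_list ys = n}"
  have card_lists: "card lists = (card A + n) choose card A"
    unfolding lists_def card_length_sum_list
    by (simp add: binomial_symmetric[of "card A"] add.commute)
  then have finite_lists: "finite lists"
    by (intro card_ge_0_finite) simp
  \<comment> \<open>The slack \<open>n - sum k A\<close> turns the inequality into an equation.\<close>
  have "bij_betw (\<lambda>k. (n - sum k A) # map k xs) ?K lists"
  proof (intro bij_betwI')
    show "(n - sum k A) # map k xs = (n - sum k' A) # map k' xs \<longleftrightarrow> k = k'"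
      if "k \<in> ?K" "k' \<in> ?K" for k k'
      using that xs(1) by (auto intro: PiE_ext)
    show "(n - sum k A) # map k xs \<in> lists" if "k \<in> ?K" for k
      using that by (simp add: lists_def sum_list_xs length_xs)
    show "\<exists>k\<in>?K. ys = (n - sum k A) # map k xs" if ys_lists: "ys \<in> lists" for ys
    proof -
      obtain y zs where ys: "ys = y # zs" "length zs = length xs" "y + sum_list zs = n"
        using ys_lists by (cases ys) (auto simp: lists_def length_xs)
      then have "zs \<in> (\<lambda>k. map k xs) ` (A \<rightarrow>\<^sub>E UNIV)"
        using bij_betw_imp_surj_on[OF bij_betw_map_PiE[where 'b = nat, OF xs(2)]] xs(1) by simp
      then obtain k where "k \<in> A \<rightarrow>\<^sub>E UNIV" "zs = map k xs"
        by (rule imageE)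
      then show ?thesis
        using ys by (intro bexI[of _ k]) (auto simp: sum_list_xs)
    qed
  qed
  then show "finite ?K" "card ?K = (card A + n) choose card A"
    using finite_lists card_lists by (simp_all add: bij_betw_finite bij_betw_same_card)
qed

subsection \<open>Dyadic cells\<close>

definition dyadic_level :: "real \<Rightarrow> nat" where
  "dyadic_level x = nat \<lfloor>log 2 (1 / x)\<rfloor>"

lemma le_dyadic_level_iff:
  assumes "0 < x" "x \<le> 1"
  shows "k \<le> dyadic_level x \<longleftrightarrow> x \<le> (1/2) ^ k"
proof -
  have "0 \<le> log 2 (1 / x)"
    using assms by simp
  then have "k \<le> dyadic_level x \<longleftrightarrow> real k \<le> log 2 (1 / x)"
    unfolding dyadic_level_def by linarith
  also have "\<dots> \<longleftrightarrow> 2 ^ k \<le> 1 / x"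
    using assms(1) by (simp add: le_log_iff powr_realpow)
  also have "\<dots> \<longleftrightarrow> x \<le> (1/2) ^ k"
    using assms(1) by (simp add: field_simps)
  finally show ?thesis .
qed

lemma dyadic_level_bounds:
  assumes "0 < x" "x \<le> 1"
  shows "(1/2) ^ Suc (dyadic_level x) < x" "x \<le> (1/2) ^ dyadic_level x"
  using le_dyadic_level_iff[OF assms, of "Suc (dyadic_level x)"]
    le_dyadic_level_iff[OF assms, of "dyadic_level x"] by simp_all

lemma sum_dyadic_level_le:
  assumes "\<And>u. u \<in> I \<Longrightarrow> 0 < x u \<and> x u \<le> 1"
    and "0 < c" "c \<le> (\<Prod>u\<in>I. x u)"
  shows "(\<Sum>u\<in>I. dyadic_level (x u)) \<le> dyadic_level c"
proof -
  have "(\<Prod>u\<in>I. x u) \<le> (\<Prod>u\<in>I. (1/2) ^ dyadic_level (x u))"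
    using assms(1) by (intro prod_mono) (auto simp: dyadic_level_bounds less_imp_le)
  then have "c \<le> (1/2) ^ (\<Sum>u\<in>I. dyadic_level (x u))"
    using assms(3) by (simp add: power_sum)
  moreover have "c \<le> 1"
    using assms by (intro order_trans[OF assms(3)] prod_le_1) (auto simp: less_imp_le)
  ultimately show ?thesis
    using le_dyadic_level_iff[OF assms(2)] by blast
qed

definition dyadic_cell :: "'i set \<Rightarrow> ('i \<Rightarrow> real) \<Rightarrow> ('i \<Rightarrow> nat) \<times> 'i set" where
  "dyadic_cell I x = (\<lambda>u\<in>I. dyadic_level \<bar>x u\<bar>, {u \<in> I. x u < 0})"

lemma dyadic_cell_eqD:
  assumes "dyadic_cell I x = dyadic_cell I y" "u \<in> I"
  shows "dyadic_level \<bar>x u\<bar> = dyadic_level \<bar>y u\<bar>" "x u < 0 \<longleftrightarrow> y u < 0"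
proof -
  have "restrict (\<lambda>u. dyadic_level \<bar>x u\<bar>) I u = restrict (\<lambda>u. dyadic_level \<bar>y u\<bar>) I u"
    using assms(1) by (simp add: dyadic_cell_def)
  then show "dyadic_level \<bar>x u\<bar> = dyadic_level \<bar>y u\<bar>"
    using assms(2) by simp
  show "x u < 0 \<longleftrightarrow> y u < 0"
    using assms by (auto simp: dyadic_cell_def)
qed

lemma card_dyadic_cells_le:
  assumes "finite I"
    and bounds: "\<And>x u. x \<in> X \<Longrightarrow> u \<in> I \<Longrightarrow> 0 < \<bar>x u\<bar> \<and> \<bar>x u\<bar> \<le> 1"
    and "0 < c" "\<And>x. x \<in> X \<Longrightarrow> c \<le> (\<Prod>u\<in>I. \<bar>x u\<bar>)"
  shows "card (dyadic_cell I ` X) \<le> ((card I + dyadic_level c) choose card I) * 2 ^ card I"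
proof -
  define levels where "levels = {k \<in> I \<rightarrow>\<^sub>E (UNIV :: nat set). sum k I \<le> dyadic_level c}"
  have "dyadic_cell I ` X \<subseteq> levels \<times> Pow I"
    using assms by (auto simp: dyadic_cell_def levels_def intro!: sum_dyadic_level_le)
  then have "card (dyadic_cell I ` X) \<le> card (levels \<times> Pow I)"
    using \<open>finite I\<close> by (intro card_mono) (simp_all add: levels_def finite_PiE_sum_le)
  then show ?thesis
    using \<open>finite I\<close>
    by (simp add: levels_def card_cartesian_product card_PiE_sum_le card_Pow)
qed

subsection \<open>Families with separated differences\<close>

lemma card_separated_le:
  fixes f :: "'a \<Rightarrow> real"
  assumes interval: "\<And>x. x \<in> A \<Longrightarrow> a < f x \<and> f x \<le> b"
    and sep: "pairwise (\<lambda>x y. \<epsilon> \<le> \<bar>f x - f y\<bar>) A"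
    and "0 < \<epsilon>"
  shows "card A \<le> nat \<lceil>(b - a) / \<epsilon>\<rceil>"
proof -
  define slot where "slot x = nat \<lfloor>(b - f x) / \<epsilon>\<rfloor>" for x
  have nonneg: "0 \<le> (b - f x) / \<epsilon>" if "x \<in> A" for x
    using interval[OF that] \<open>0 < \<epsilon>\<close> by simp
  have "inj_on slot A"
  proof (rule inj_onI, rule ccontr)
    fix x y assume xy: "x \<in> A" "y \<in> A" "slot x = slot y" "x \<noteq> y"
    then have "\<lfloor>(b - f x) / \<epsilon>\<rfloor> = \<lfloor>(b - f y) / \<epsilon>\<rfloor>"
      using nonneg by (simp add: slot_def eq_nat_nat_iff)
    then have "\<bar>(b - f x) / \<epsilon> - (b - f y) / \<epsilon>\<bar> < 1" by linarith
    moreover have "(b - f x) / \<epsilon> - (b - f y) / \<epsilon> = (f y - f x) / \<epsilon>"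
      by (simp add: diff_divide_distrib)
    ultimately have "\<bar>f x - f y\<bar> < \<epsilon>"
      using \<open>0 < \<epsilon>\<close> by (simp add: abs_divide abs_minus_commute)
    then show False
      using pairwiseD[OF sep] xy by fastforce
  qed
  moreover have "slot ` A \<subseteq> {..<nat \<lceil>(b - a) / \<epsilon>\<rceil>}"
  proof (rule image_subsetI)
    fix x assume "x \<in> A"
    have "(b - f x) / \<epsilon> < (b - a) / \<epsilon>"
      using interval[OF \<open>x \<in> A\<close>] \<open>0 < \<epsilon>\<close> by (simp add: divide_strict_right_mono)
    then show "slot x \<in> {..<nat \<lceil>(b - a) / \<epsilon>\<rceil>}"
      using nonneg[OF \<open>x \<in> A\<close>] unfolding slot_def lessThan_iff by linarith
  qed
  ultimately show ?thesis
    using card_inj_on_le[OF _ _ finite_lessThan] by (metis card_lessThan)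
qed

definition product_separated :: "'i set \<Rightarrow> real \<Rightarrow> ('a \<Rightarrow> 'i \<Rightarrow> real) \<Rightarrow> 'a set \<Rightarrow> bool" where
  "product_separated I \<delta> s A \<longleftrightarrow> pairwise (\<lambda>i j. \<delta> \<le> (\<Prod>u\<in>I. \<bar>s i u - s j u\<bar>)) A"

lemma product_separated_subset:
  "product_separated I \<delta> s A \<Longrightarrow> B \<subseteq> A \<Longrightarrow> product_separated I \<delta> s B"
  unfolding product_separated_def by (rule pairwise_subset)

lemma card_product_separated_box_le:
  assumes "finite I" "I \<noteq> {}" "0 < \<delta>"
    and box: "\<And>j u. j \<in> A \<Longrightarrow> u \<in> I \<Longrightarrow> a u < s j u \<and> s j u \<le> b u"
    and sep: "product_separated I \<delta> s A"
  shows "card A \<le> nat \<lceil>(\<Prod>u\<in>I. b u - a u) / \<delta>\<rceil>"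
proof (cases "A = {}")
  case False
  then have side_pos: "0 < b u - a u" if "u \<in> I" for u
    using box that by fastforce
  obtain v where v: "v \<in> I"
    using \<open>I \<noteq> {}\<close> by blast
  define W where "W = (\<Prod>u\<in>I - {v}. b u - a u)"
  have "0 < W"
    unfolding W_def using side_pos by (intro prod_pos) auto
  have "pairwise (\<lambda>i j. \<delta> / W \<le> \<bar>s i v - s j v\<bar>) A"
  proof (rule pairwiseI)
    fix i j assume ij: "i \<in> A" "j \<in> A" "i \<noteq> j"
    have "\<delta> \<le> (\<Prod>u\<in>I. \<bar>s i u - s j u\<bar>)"
      using pairwiseD[OF sep[unfolded product_separated_def]] ij by blast
    also have "\<dots> = \<bar>s i v - s j v\<bar> * (\<Prod>u\<in>I - {v}. \<bar>s i u - s j u\<bar>)"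
      by (rule prod.remove[OF \<open>finite I\<close> v])
    also have "\<dots> \<le> \<bar>s i v - s j v\<bar> * W"
      unfolding W_def
    proof (intro mult_left_mono prod_mono conjI)
      fix u assume "u \<in> I - {v}"
      then show "\<bar>s i u - s j u\<bar> \<le> b u - a u"
        using box[OF ij(1), of u] box[OF ij(2), of u] by (simp add: abs_le_iff)
    qed simp_all
    finally show "\<delta> / W \<le> \<bar>s i v - s j v\<bar>"
      using \<open>0 < W\<close> by (simp add: field_simps)
  qed
  then have "card A \<le> nat \<lceil>(b v - a v) / (\<delta> / W)\<rceil>"
    using box v \<open>0 < \<delta>\<close> \<open>0 < W\<close> by (intro card_separated_le) auto
  also have "(b v - a v) / (\<delta> / W) = (\<Prod>u\<in>I. b u - a u) / \<delta>"
    unfolding W_def prod.remove[OF \<open>finite I\<close> v] by simp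
  finally show ?thesis .
qed simp

lemma ceiling_le_mult:
  fixes c x :: real
  assumes "2 \<le> c" "1 \<le> c * x"
  shows "\<lceil>x\<rceil> \<le> c * x"
proof (cases "x \<le> 1")
  case True
  then have "\<lceil>x\<rceil> \<le> 1" by (simp add: ceiling_le_iff)
  then show ?thesis using assms(2) by linarith
next
  case False
  then have "2 * x \<le> c * x" using assms(1) by (intro mult_right_mono) auto
  then show ?thesis using False by linarith
qed

lemma card_product_separated_doubling_box_le:
  assumes I: "finite I" "I \<noteq> {}" and "0 < \<delta>"
    and r_pos: "\<And>u. u \<in> I \<Longrightarrow> 0 < r u"
    and box: "\<And>j u. j \<in> A \<Longrightarrow> u \<in> I \<Longrightarrow> r u < t j u \<and> t j u \<le> 2 * r u"
    and low: "\<And>j. j \<in> A \<Longrightarrow> \<delta> \<le> (\<Prod>u\<in>I. t j u)"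
    and sep: "product_separated I \<delta> t A"
  shows "real (card A) \<le> 2 ^ card I * ((\<Prod>u\<in>I. r u) / \<delta>)"
proof (cases "A = {}")
  case True
  then show ?thesis
    using r_pos \<open>0 < \<delta>\<close> by (simp add: prod_nonneg less_imp_le)
next
  case False
  then obtain i where "i \<in> A" by blast
  define V where "V = (\<Prod>u\<in>I. r u)"
  have "0 < V"
    unfolding V_def using r_pos by (intro prod_pos) auto
  have "\<delta> \<le> (\<Prod>u\<in>I. t i u)"
    by (rule low[OF \<open>i \<in> A\<close>])
  also have "\<dots> \<le> (\<Prod>u\<in>I. 2 * r u)"
    using box[OF \<open>i \<in> A\<close>] less_trans[OF r_pos]
    by (intro prod_mono conjI) (simp_all add: less_imp_le)
  also have "\<dots> = 2 ^ card I * V"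
    by (simp add: V_def prod.distrib)
  finally have "1 \<le> 2 ^ card I * (V / \<delta>)"
    using \<open>0 < \<delta>\<close> by simp
  moreover have "(2::real) ^ 1 \<le> 2 ^ card I"
    using I by (intro power_increasing) (simp_all add: Suc_le_eq card_gt_0_iff)
  ultimately have "\<lceil>V / \<delta>\<rceil> \<le> 2 ^ card I * (V / \<delta>)"
    by (intro ceiling_le_mult) simp_all
  moreover have "card A \<le> nat \<lceil>V / \<delta>\<rceil>"
    using card_product_separated_box_le[OF I \<open>0 < \<delta>\<close> box sep] by (simp add: V_def)
  moreover have "0 \<le> V / \<delta>"
    using \<open>0 < V\<close> \<open>0 < \<delta>\<close> by simp
  ultimately show ?thesis
    unfolding V_def by linarith
qed

lemma sum_inverse_prod_doubling_box_le:
  fixes t :: "'a \<Rightarrow> 'i \<Rightarrow> real"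
  assumes I: "finite I" "I \<noteq> {}" and "0 < \<delta>"
    and r_pos: "\<And>u. u \<in> I \<Longrightarrow> 0 < r u"
    and box: "\<And>j u. j \<in> A \<Longrightarrow> u \<in> I \<Longrightarrow> r u < t j u \<and> t j u \<le> 2 * r u"
    and low: "\<And>j. j \<in> A \<Longrightarrow> \<delta> \<le> (\<Prod>u\<in>I. t j u)"
    and sep: "product_separated I \<delta> t A"
  shows "(\<Sum>j\<in>A. \<Prod>u\<in>I. inverse (t j u)) \<le> 2 ^ card I / \<delta>"
proof -
  define V where "V = (\<Prod>u\<in>I. r u)"
  have "0 < V"
    unfolding V_def using r_pos by (intro prod_pos) auto
  have "(\<Prod>u\<in>I. inverse (t j u)) \<le> (\<Prod>u\<in>I. inverse (r u))" if "j \<in> A" for j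
    using r_pos box[OF that] less_trans[OF r_pos]
    by (intro prod_mono conjI) (simp_all add: less_imp_le)
  then have "(\<Sum>j\<in>A. \<Prod>u\<in>I. inverse (t j u)) \<le> real (card A) * inverse V"
    unfolding V_def using prod_inversef[of r I] by (intro sum_bounded_above) (simp add: comp_def)
  also have "\<dots> \<le> 2 ^ card I * (V / \<delta>) * inverse V"
    using card_product_separated_doubling_box_le[OF assms] \<open>0 < V\<close>
    by (intro mult_right_mono) (auto simp: V_def)
  also have "\<dots> = 2 ^ card I / \<delta>"
    using \<open>0 < V\<close> by simp
  finally show ?thesis .
qed

lemma sum_inverse_prod_dyadic_cell_le:
  fixes s :: "'a \<Rightarrow> 'i \<Rightarrow> real"
  assumes I: "finite I" "I \<noteq> {}" and "0 < \<delta>"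
    and bounds: "\<And>j u. j \<in> A \<Longrightarrow> u \<in> I \<Longrightarrow> 0 < \<bar>s j u\<bar> \<and> \<bar>s j u\<bar> \<le> 1"
    and cell: "\<And>j. j \<in> A \<Longrightarrow> dyadic_cell I (s j) = dyadic_cell I x"
    and low: "\<And>j. j \<in> A \<Longrightarrow> \<delta> \<le> (\<Prod>u\<in>I. \<bar>s j u\<bar>)"
    and sep: "product_separated I \<delta> s A"
  shows "(\<Sum>j\<in>A. \<Prod>u\<in>I. inverse \<bar>s j u\<bar>) \<le> 2 ^ card I / \<delta>"
proof (rule sum_inverse_prod_doubling_box_le[where r = "\<lambda>u. (1/2) ^ Suc (dyadic_level \<bar>x u\<bar>)"])
  fix j u assume "j \<in> A" "u \<in> I"
  then show "(1/2) ^ Suc (dyadic_level \<bar>x u\<bar>) < \<bar>s j u\<bar> \<and>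
      \<bar>s j u\<bar> \<le> 2 * (1/2) ^ Suc (dyadic_level \<bar>x u\<bar>)"
    using dyadic_level_bounds[of "\<bar>s j u\<bar>"] bounds dyadic_cell_eqD(1)[OF cell] by simp
next
  have "\<bar>\<bar>s i u\<bar> - \<bar>s j u\<bar>\<bar> = \<bar>s i u - s j u\<bar>" if "i \<in> A" "j \<in> A" "u \<in> I" for i j u
  proof -
    have "s i u < 0 \<longleftrightarrow> s j u < 0"
      using dyadic_cell_eqD(2)[OF cell] that by blast
    then show ?thesis by (cases "s i u < 0") auto
  qed
  then show "product_separated I \<delta> (\<lambda>j u. \<bar>s j u\<bar>) A"
    using sep by (simp add: product_separated_def pairwise_def)
qed (use I \<open>0 < \<delta>\<close> low in auto)

lemma sum_inverse_prod_product_separated_le: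
  fixes s :: "'a \<Rightarrow> 'i \<Rightarrow> real"
  assumes I: "finite I" "I \<noteq> {}" and "finite S" and \<delta>: "0 < \<delta>" "\<delta> \<le> c"
    and le_1: "\<And>j u. j \<in> S \<Longrightarrow> u \<in> I \<Longrightarrow> \<bar>s j u\<bar> \<le> 1"
    and low: "\<And>j. j \<in> S \<Longrightarrow> c \<le> (\<Prod>u\<in>I. \<bar>s j u\<bar>)"
    and sep: "product_separated I \<delta> s S"
  shows "(\<Sum>j\<in>S. \<Prod>u\<in>I. inverse \<bar>s j u\<bar>) \<le>
    4 ^ card I / \<delta> * real ((card I + dyadic_level c) choose card I)"
proof -
  have "0 < c" using \<delta> by simp
  have bounds: "0 < \<bar>s j u\<bar> \<and> \<bar>s j u\<bar> \<le> 1" if "j \<in> S" "u \<in> I" for j u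
  proof -
    have "(\<Prod>u\<in>I. \<bar>s j u\<bar>) \<noteq> 0"
      using low[OF \<open>j \<in> S\<close>] \<open>0 < c\<close> by linarith
    then show ?thesis
      using le_1[OF that] \<open>finite I\<close> \<open>u \<in> I\<close> by auto
  qed
  let ?cell = "\<lambda>j. dyadic_cell I (s j)"
  let ?N = "(card I + dyadic_level c) choose card I"
  have "card (?cell ` S) \<le> ?N * 2 ^ card I"
    using card_dyadic_cells_le[of I "s ` S" c] \<open>finite I\<close> bounds \<open>0 < c\<close> low
    by (auto simp: image_image)
  then have cells: "real (card (?cell ` S)) \<le> real ?N * 2 ^ card I"
    using of_nat_mono by fastforce
  have "(\<Sum>j\<in>S. \<Prod>u\<in>I. inverse \<bar>s j u\<bar>) =
      (\<Sum>y\<in>?cell ` S. \<Sum>j\<in>{j \<in> S. ?cell j = y}. \<Prod>u\<in>I. inverse \<bar>s j u\<bar>)"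
    by (rule sum.image_gen[OF \<open>finite S\<close>])
  also have "\<dots> \<le> real (card (?cell ` S)) * (2 ^ card I / \<delta>)"
  proof (intro sum_bounded_above, elim imageE)
    fix y i assume "y = ?cell i"
    show "(\<Sum>j\<in>{j \<in> S. ?cell j = y}. \<Prod>u\<in>I. inverse \<bar>s j u\<bar>) \<le> 2 ^ card I / \<delta>"
      using I \<delta> bounds order_trans[OF \<delta>(2) low] product_separated_subset[OF sep] \<open>y = ?cell i\<close>
      by (intro sum_inverse_prod_dyadic_cell_le[where x = "s i"]) auto
  qed
  also have "\<dots> \<le> (real ?N * 2 ^ card I) * (2 ^ card I / \<delta>)"
    using cells \<delta> by (intro mult_right_mono) auto
  also have "\<dots> = 4 ^ card I / \<delta> * real ?N"
    by (simp flip: power_mult_distrib)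
  finally show ?thesis .
qed

subsection \<open>Residues of integer points\<close>

definition centered_residue :: "real \<Rightarrow> real" where
  "centered_residue y = y - of_int (round y)"

lemma dist_nearest_int_eq_abs_centered_residue: "dist_nearest_int y = \<bar>centered_residue y\<bar>"
  by (simp add: dist_nearest_int_def centered_residue_def)

lemma abs_centered_residue_le: "\<bar>centered_residue y\<bar> \<le> 1 / 2"
  using of_int_round_abs_le[of y] by (simp add: centered_residue_def abs_minus_commute)

lemma dist_nearest_int_diff_le:
  "dist_nearest_int (x - y) \<le> \<bar>centered_residue x - centered_residue y\<bar>"
proof -
  have "\<bar>(x - y) - of_int (round (x - y))\<bar> \<le> \<bar>(x - y) - of_int (round x - round y)\<bar>"
    by (rule round_diff_minimal)
  then show ?thesis
    by (simp add: dist_nearest_int_def centered_residue_def algebra_simps)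
qed

lemma real_vec_diff: "real_vec (i - j) = real_vec i - real_vec j"
  by (simp add: real_vec_def vec_eq_iff)

lemma int_sup_norm_le_iff: "int_sup_norm j \<le> n \<longleftrightarrow> (\<forall>i. \<bar>j $ i\<bar> \<le> int n)"
  unfolding int_sup_norm_def by (auto simp: nat_le_iff)

lemma int_sup_norm_ge_1: "j \<noteq> 0 \<Longrightarrow> 1 \<le> int_sup_norm j"
  using int_sup_norm_le_iff[of j 0] by (auto simp: vec_eq_iff not_less_eq_eq)

lemma int_sup_norm_diff_le: "int_sup_norm (i - j) \<le> int_sup_norm i + int_sup_norm j"
  unfolding int_sup_norm_le_iff
proof
  fix u
  have "\<bar>i $ u\<bar> \<le> int (int_sup_norm i)" "\<bar>j $ u\<bar> \<le> int (int_sup_norm j)"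
    using int_sup_norm_le_iff by blast+
  then show "\<bar>(i - j) $ u\<bar> \<le> int (int_sup_norm i + int_sup_norm j)"
    by simp
qed

lemma finite_int_sup_norm_le: "finite {j :: int ^ 'm. int_sup_norm j \<le> n}"
proof (rule finite_imageD)
  have "vec_nth ` {j :: int ^ 'm. int_sup_norm j \<le> n} \<subseteq> UNIV \<rightarrow>\<^sub>E {- int n..int n}"
    by (auto simp: int_sup_norm_le_iff abs_le_iff minus_le_iff)
  then show "finite (vec_nth ` {j :: int ^ 'm. int_sup_norm j \<le> n})"
    by (rule finite_subset) (simp add: finite_PiE)
qed (simp add: inj_on_def vec_nth_inject)

definition multiplicatively_badly_approximable ::
    "(nat \<Rightarrow> real) \<Rightarrow> real ^ 'm ^ 'l \<Rightarrow> bool" where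
  "multiplicatively_badly_approximable \<phi> M \<longleftrightarrow>
    (\<forall>j :: int ^ 'm. j \<noteq> 0 \<longrightarrow>
      \<phi> (int_sup_norm j) \<le> (\<Prod>u\<in>UNIV. dist_nearest_int (real_vec j \<bullet> row u M)))"

lemma multiplicatively_badly_approximable_norm_leD:
  assumes "multiplicatively_badly_approximable \<phi> M" "antimono_on {1..} \<phi>"
    and "j \<noteq> 0" "int_sup_norm j \<le> n"
  shows "\<phi> n \<le> (\<Prod>u\<in>UNIV. dist_nearest_int (real_vec j \<bullet> row u M))"
proof -
  have "\<phi> n \<le> \<phi> (int_sup_norm j)"
    using assms(4) int_sup_norm_ge_1[OF assms(3)] by (intro monotone_onD[OF assms(2)]) auto
  then show ?thesis
    using assms(1,3) unfolding multiplicatively_badly_approximable_def by (meson order_trans)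
qed

definition row_residue :: "real ^ 'm ^ 'l \<Rightarrow> int ^ 'm \<Rightarrow> 'l \<Rightarrow> real" where
  "row_residue M j u = centered_residue (real_vec j \<bullet> row u M)"

lemma dist_nearest_int_row_eq: "dist_nearest_int (real_vec j \<bullet> row u M) = \<bar>row_residue M j u\<bar>"
  by (simp add: row_residue_def dist_nearest_int_eq_abs_centered_residue)

lemma abs_row_residue_le_1: "\<bar>row_residue M j u\<bar> \<le> 1"
  unfolding row_residue_def by (rule order_trans[OF abs_centered_residue_le]) simp

lemma product_separated_row_residue:
  fixes M :: "real ^ 'm ^ 'l"
  assumes "multiplicatively_badly_approximable \<phi> M" "antimono_on {1..} \<phi>"
  shows "product_separated UNIV (\<phi> (2 * J)) (row_residue M) {j. int_sup_norm j \<le> J}"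
  unfolding product_separated_def
proof (rule pairwiseI)
  fix i j :: "int ^ 'm"
  assume ij: "i \<in> {j. int_sup_norm j \<le> J}" "j \<in> {j. int_sup_norm j \<le> J}" "i \<noteq> j"
  then have "int_sup_norm (i - j) \<le> 2 * J"
    using int_sup_norm_diff_le[of i j] by simp
  then have "\<phi> (2 * J) \<le> (\<Prod>u\<in>UNIV. dist_nearest_int (real_vec (i - j) \<bullet> row u M))"
    using assms ij(3) by (intro multiplicatively_badly_approximable_norm_leD) auto
  also have "\<dots> \<le> (\<Prod>u\<in>UNIV. \<bar>row_residue M i u - row_residue M j u\<bar>)"
    unfolding real_vec_diff inner_diff_left row_residue_def
    by (intro prod_mono conjI dist_nearest_int_diff_le) (simp add: dist_nearest_int_def)
  finally show "\<phi> (2 * J) \<le> (\<Prod>u\<in>UNIV. \<bar>row_residue M i u - row_residue M j u\<bar>)" .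
qed

theorem theorem2p2:
  fixes M :: "real ^ 'm ^ 'l" and \<phi> :: "nat \<Rightarrow> real" and J :: nat
  assumes \<phi>_range: "\<And>n. n \<ge> 1 \<Longrightarrow> 0 < \<phi> n \<and> \<phi> n < 1"
    and \<phi>_noninc: "antimono_on {1..} \<phi>"
    and M_bound: "\<And>j :: int ^ 'm. j \<noteq> 0 \<Longrightarrow>
      (\<Prod>u\<in>UNIV. dist_nearest_int (real_vec j \<bullet> row u M)) \<ge> \<phi> (int_sup_norm j)"
    and J_pos: "J \<ge> 1"
  shows "(\<Sum>j \<in> {j :: int ^ 'm. j \<noteq> 0 \<and> int_sup_norm j \<le> J}.
            \<Prod>u\<in>UNIV. inverse (dist_nearest_int (real_vec j \<bullet> row u M)))
         \<le> 4 ^ CARD('l) / \<phi> (2 * J)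
            * real ((CARD('l) + nat \<lfloor>log 2 (1 / \<phi> J)\<rfloor>) choose CARD('l))"
  unfolding dist_nearest_int_row_eq dyadic_level_def[symmetric]
proof (rule sum_inverse_prod_product_separated_le)
  have M: "multiplicatively_badly_approximable \<phi> M"
    using M_bound by (simp add: multiplicatively_badly_approximable_def)
  show "finite {j :: int ^ 'm. j \<noteq> 0 \<and> int_sup_norm j \<le> J}"
    by (rule finite_subset[OF _ finite_int_sup_norm_le[of J]]) auto
  show "0 < \<phi> (2 * J)" "\<phi> (2 * J) \<le> \<phi> J"
    using \<phi>_range[of "2 * J"] J_pos by (auto intro: monotone_onD[OF \<phi>_noninc])
  show "\<phi> J \<le> (\<Prod>u\<in>UNIV. \<bar>row_residue M j u\<bar>)"
    if "j \<in> {j. j \<noteq> 0 \<and> int_sup_norm j \<le> J}" for j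
    using multiplicatively_badly_approximable_norm_leD[OF M \<phi>_noninc] that
    by (simp add: dist_nearest_int_row_eq)
  show "product_separated UNIV (\<phi> (2 * J)) (row_residue M) {j. j \<noteq> 0 \<and> int_sup_norm j \<le> J}"
    by (rule product_separated_subset[OF product_separated_row_residue[OF M \<phi>_noninc]]) auto
qed (simp_all add: abs_row_residue_le_1)

end
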